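(* Let $\mathbf{k}$ be a field of characteristic not equal to $2$, let $(A,\cdot)$ be a $\mathbf{k}$-algebra with finite $\mathbf{k}$-dimension and let $r\in A\otimes A$. Let $\alpha=(r-r^t)/2$ and $\beta=(r+r^t)/2$. Suppose that $\beta:A^*\to A$ is a balanced $A$-bimodule homomorphism, that is, $\beta$ is invariant: $(\mathrm{id}\otimes L(x)-R(x)\otimes\mathrm{id})\beta=0$ for all $x\in A$. If $\alpha$ is an extended $\mathcal{O}$-operator with modification $\beta$ of mass $\kappa$ for some $\kappa\in\mathbf{k}$, then the product $$a^*\ast b^*=R^*(r(a^* ))b^*-a^*L^*(r^t(b^* )),\qquad a^*,b^*\in A^*,$$ defines a $\mathbf{k}$-algebra structure on $A^*$ and $r$ is a solution of the generalized associative Yang-Baxter equation in $A$.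
   Context: A $\mathbf{k}$-algebra is an associative, not necessarily unital, algebra over $\mathbf{k}$. For $x\in A$: $L(x)y=xy$, $yR(x)=yx$. $(A^*,R^*,L^* )$ is the $A$-bimodule $A^*$ with left action $\langle R^*(x)a^*,y\rangle=\langle a^*,yx\rangle$ and right action $\langle a^*L^*(x),y\rangle=\langle a^*,xy\rangle$. For $s=\sum_i s_i\otimes t_i$, $(\mathrm{id}\otimes L(x)-R(x)\otimes\mathrm{id})s=\sum_i(s_i\otimes xt_i-s_ix\otimes t_i)$. $r=\sum_i a_i\otimes b_i\in A\otimes A$ is identified with the linear map $r:A^*\to A$, $r(u)=\sum_i\langle u,a_i\rangle b_i$, and $r^t:A^*\to A$ is $r^t(v)=\sum_i\langle v,b_i\rangle a_i$. $\beta:A^*\to A$ is a balanced $A$-bimodule homomorphism if $\beta(R^*(x)a^* )=x\cdot\beta(a^* )$, $\beta(a^*L^*(x))=\beta(a^* )\cdot x$ and $R^*(\beta(a^* ))b^*=a^*L^*(\beta(b^* ))$ for all $x\in A$, $a^*,b^*\in A^*$. Then $\alpha:A^*\to A$ is an extended $\mathcal{O}$-operator with modification $\beta$ of mass $\kappa$ if $\alpha(a^* )\cdot\alpha(b^* )-\alpha(R^*(\alpha(a^* ))b^*+a^*L^*(\alpha(b^* )))=\kappa\,\beta(a^* )\cdot\beta(b^* )$ for all $a^*,b^*\in A^*$. $r$ is a solution of the generalized associative Yang-Baxter equation (GAYBE) in $A$ if $(\mathrm{id}\otimes\mathrm{id}\otimes L(x)-R(x)\otimes\mathrm{id}\otimes\mathrm{id})(r_{12}r_{13}+r_{13}r_{23}-r_{23}r_{12})=0$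 for all $x\in A$, where $r_{12}r_{13}=\sum_{i,j}a_ia_j\otimes b_i\otimes b_j$, $r_{13}r_{23}=\sum_{i,j}a_i\otimes a_j\otimes b_ib_j$, $r_{23}r_{12}=\sum_{i,j}a_i\otimes a_jb_i\otimes b_j$, and $(\mathrm{id}\otimes\mathrm{id}\otimes L(x)-R(x)\otimes\mathrm{id}\otimes\mathrm{id})(p\otimes q\otimes s)=p\otimes q\otimes xs-px\otimes q\otimes s$. *)

theory Defs
  imports Complex_Main "HOL-Library.Poly_Mapping" "HOL-Library.Function_Algebras"
begin

section \<open>Algebras, the dual space and its bimodule structure\<close>

text \<open>Associativity and distributivity of the product, without a unit, come from class \<open>ring\<close>.\<close>

locale k_algebra = vector_space scale
  for scale :: "'k::field \<Rightarrow> 'a::ring \<Rightarrow> 'a" +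
  assumes scale_mult_left: "scale c x * y = scale c (x * y)"
    and scale_mult_right: "x * scale c y = scale c (x * y)"

locale fd_k_algebra = k_algebra scale
  for scale :: "'k::field \<Rightarrow> 'a::ring \<Rightarrow> 'a" +
  assumes finite_dim: "\<exists>B. finite B \<and> span B = UNIV"

text \<open>Algebra structures on a subspace \<open>V\<close> of an ambient vector space; needed because the dual
  space is a subspace of a function type rather than a type.\<close>

definition k_algebra_on ::
  "('k::field \<Rightarrow> 'v::ab_group_add \<Rightarrow> 'v) \<Rightarrow> 'v set \<Rightarrow> ('v \<Rightarrow> 'v \<Rightarrow> 'v) \<Rightarrow> bool" where
  "k_algebra_on s V m \<longleftrightarrow>
     vector_space s \<and> module.subspace s V \<and>
     (\<forall>u\<in>V. \<forall>v\<in>V. m u v \<in> V) \<and>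
     (\<forall>u\<in>V. \<forall>v\<in>V. \<forall>w\<in>V. m (u + v) w = m u w + m v w) \<and>
     (\<forall>u\<in>V. \<forall>v\<in>V. \<forall>w\<in>V. m u (v + w) = m u v + m u w) \<and>
     (\<forall>c. \<forall>u\<in>V. \<forall>v\<in>V. m (s c u) v = s c (m u v)) \<and>
     (\<forall>c. \<forall>u\<in>V. \<forall>v\<in>V. m u (s c v) = s c (m u v)) \<and>
     (\<forall>u\<in>V. \<forall>v\<in>V. \<forall>w\<in>V. m (m u v) w = m u (m v w))"

definition dual :: "('k::field \<Rightarrow> 'a::ab_group_add \<Rightarrow> 'a) \<Rightarrow> ('a \<Rightarrow> 'k) set" where
  "dual s = {u. Vector_Spaces.linear s (*) u}"

definition fun_scale :: "'k::field \<Rightarrow> ('a \<Rightarrow> 'k) \<Rightarrow> ('a \<Rightarrow> 'k)" where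
  "fun_scale c u = (\<lambda>y. c * u y)"

text \<open>\<open>R_dual x u\<close> is $R^*(x)u$, and \<open>L_dual u x\<close> is $u L^*(x)$ (a right action).\<close>

definition R_dual :: "'a::ring \<Rightarrow> ('a \<Rightarrow> 'k) \<Rightarrow> ('a \<Rightarrow> 'k)" where
  "R_dual x u = (\<lambda>y. u (y * x))"

definition L_dual :: "('a \<Rightarrow> 'k) \<Rightarrow> 'a::ring \<Rightarrow> ('a \<Rightarrow> 'k)" where
  "L_dual u x = (\<lambda>y. u (x * y))"

definition linear_on_dual ::
  "('k::field \<Rightarrow> 'a::ring \<Rightarrow> 'a) \<Rightarrow> (('a \<Rightarrow> 'k) \<Rightarrow> 'a) \<Rightarrow> bool" where
  "linear_on_dual s f \<longleftrightarrow>
     (\<forall>u\<in>dual s. \<forall>v\<in>dual s. f (u + v) = f u + f v) \<and>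
     (\<forall>c. \<forall>u\<in>dual s. f (fun_scale c u) = s c (f u))"

definition balanced_bimodule_hom ::
  "('k::field \<Rightarrow> 'a::ring \<Rightarrow> 'a) \<Rightarrow> (('a \<Rightarrow> 'k) \<Rightarrow> 'a) \<Rightarrow> bool" where
  "balanced_bimodule_hom s \<beta> \<longleftrightarrow>
     linear_on_dual s \<beta> \<and>
     (\<forall>x. \<forall>u\<in>dual s. \<beta> (R_dual x u) = x * \<beta> u) \<and>
     (\<forall>x. \<forall>u\<in>dual s. \<beta> (L_dual u x) = \<beta> u * x) \<and>
     (\<forall>u\<in>dual s. \<forall>v\<in>dual s. R_dual (\<beta> u) v = L_dual u (\<beta> v))"

definition extended_O_operator ::
  "('k::field \<Rightarrow> 'a::ring \<Rightarrow> 'a) \<Rightarrow> (('a \<Rightarrow> 'k) \<Rightarrow> 'a) \<Rightarrow> (('a \<Rightarrow> 'k) \<Rightarrow> 'a) \<Rightarrow> 'k \<Rightarrow> bool" where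
  "extended_O_operator s \<alpha> \<beta> \<kappa> \<longleftrightarrow>
     linear_on_dual s \<alpha> \<and>
     (\<forall>u\<in>dual s. \<forall>v\<in>dual s.
        \<alpha> u * \<alpha> v - \<alpha> (R_dual (\<alpha> u) v + L_dual u (\<alpha> v)) = s \<kappa> (\<beta> u * \<beta> v))"


section \<open>Tensor powers\<close>

text \<open>The tensor square and cube of \<open>A\<close> are the free vector spaces on \<open>A \<times> A\<close> and
  \<open>A \<times> A \<times> A\<close> modulo the subspaces generated by the bilinearity, respectively trilinearity,
  relations. Tensors are cosets of these subspaces; operations on tensors are given on
  representatives.\<close>

definition free_scale :: "'k::field \<Rightarrow> ('b \<Rightarrow>\<^sub>0 'k) \<Rightarrow> ('b \<Rightarrow>\<^sub>0 'k)" where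
  "free_scale c = Poly_Mapping.map ((*) c)"

abbreviation gen :: "'b \<Rightarrow> ('b \<Rightarrow>\<^sub>0 'k::field)" where
  "gen x \<equiv> Poly_Mapping.single x 1"

text \<open>The linear extension of a map \<open>f\<close> on the generators.\<close>

definition lin_ext ::
  "('k::field \<Rightarrow> 'v::ab_group_add \<Rightarrow> 'v) \<Rightarrow> ('b \<Rightarrow> 'v) \<Rightarrow> ('b \<Rightarrow>\<^sub>0 'k) \<Rightarrow> 'v" where
  "lin_ext s f p = (\<Sum>x\<in>Poly_Mapping.keys p. s (Poly_Mapping.lookup p x) (f x))"

definition rel2_gens :: "('k::field \<Rightarrow> 'a::ring \<Rightarrow> 'a) \<Rightarrow> ('a \<times> 'a \<Rightarrow>\<^sub>0 'k) set" where
  "rel2_gens s =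
     {gen (a + a', b) - gen (a, b) - gen (a', b) | a a' b. True} \<union>
     {gen (a, b + b') - gen (a, b) - gen (a, b') | a b b'. True} \<union>
     {gen (s c a, b) - free_scale c (gen (a, b)) | c a b. True} \<union>
     {gen (a, s c b) - free_scale c (gen (a, b)) | c a b. True}"

definition rel3_gens :: "('k::field \<Rightarrow> 'a::ring \<Rightarrow> 'a) \<Rightarrow> ('a \<times> 'a \<times> 'a \<Rightarrow>\<^sub>0 'k) set" where
  "rel3_gens s =
     {gen (a + a', b, d) - gen (a, b, d) - gen (a', b, d) | a a' b d. True} \<union>
     {gen (a, b + b', d) - gen (a, b, d) - gen (a, b', d) | a b b' d. True} \<union>
     {gen (a, b, d + d') - gen (a, b, d) - gen (a, b, d') | a b d d'. True} \<union>
     {gen (s c a, b, d) - free_scale c (gen (a, b, d)) | c a b d. True} \<union>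
     {gen (a, s c b, d) - free_scale c (gen (a, b, d)) | c a b d. True} \<union>
     {gen (a, b, s c d) - free_scale c (gen (a, b, d)) | c a b d. True}"

definition rel2 :: "('k::field \<Rightarrow> 'a::ring \<Rightarrow> 'a) \<Rightarrow> ('a \<times> 'a \<Rightarrow>\<^sub>0 'k) set" where
  "rel2 s = module.span free_scale (rel2_gens s)"

definition rel3 :: "('k::field \<Rightarrow> 'a::ring \<Rightarrow> 'a) \<Rightarrow> ('a \<times> 'a \<times> 'a \<Rightarrow>\<^sub>0 'k) set" where
  "rel3 s = module.span free_scale (rel3_gens s)"

definition coset :: "'v::ab_group_add set \<Rightarrow> 'v \<Rightarrow> 'v set" where
  "coset N p = {q. q - p \<in> N}"

text \<open>The zero tensors are \<open>rel2 s\<close> and \<open>rel3 s\<close>.\<close>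

definition tensor2 :: "('k::field \<Rightarrow> 'a::ring \<Rightarrow> 'a) \<Rightarrow> ('a \<times> 'a \<Rightarrow>\<^sub>0 'k) set set" where
  "tensor2 s = range (coset (rel2 s))"

text \<open>Maps induced on quotients: \<open>N\<close> is the subspace that is factored out in the target.\<close>

definition quot_map :: "'w::ab_group_add set \<Rightarrow> ('v \<Rightarrow> 'w) \<Rightarrow> 'v set \<Rightarrow> 'w set" where
  "quot_map N F X = (\<Union>p\<in>X. coset N (F p))"

definition quot_add :: "'v::ab_group_add set \<Rightarrow> 'v set \<Rightarrow> 'v set \<Rightarrow> 'v set" where
  "quot_add N X Y = (\<Union>p\<in>X. \<Union>q\<in>Y. coset N (p + q))"

definition quot_diff :: "'v::ab_group_add set \<Rightarrow> 'v set \<Rightarrow> 'v set \<Rightarrow> 'v set" where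
  "quot_diff N X Y = (\<Union>p\<in>X. \<Union>q\<in>Y. coset N (p - q))"

definition scale2 ::
  "('k::field \<Rightarrow> 'a::ring \<Rightarrow> 'a) \<Rightarrow> 'k \<Rightarrow> ('a \<times> 'a \<Rightarrow>\<^sub>0 'k) set \<Rightarrow> ('a \<times> 'a \<Rightarrow>\<^sub>0 'k) set" where
  "scale2 s c = quot_map (rel2 s) (free_scale c)"

text \<open>The flip $a \otimes b \mapsto b \otimes a$, giving $r^t$ as a tensor.\<close>

definition flip ::
  "('k::field \<Rightarrow> 'a::ring \<Rightarrow> 'a) \<Rightarrow> ('a \<times> 'a \<Rightarrow>\<^sub>0 'k) set \<Rightarrow> ('a \<times> 'a \<Rightarrow>\<^sub>0 'k) set" where
  "flip s = quot_map (rel2 s) (lin_ext free_scale (\<lambda>(a, b). gen (b, a)))"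

text \<open>The linear map $u \mapsto \sum_i \langle u, a_i\rangle b_i$ identified with
  $r = \sum_i a_i \otimes b_i$. For \<open>u\<close> in the dual space all representatives of the coset \<open>r\<close>
  give the same value.\<close>

definition tensor_map ::
  "('k::field \<Rightarrow> 'a::ring \<Rightarrow> 'a) \<Rightarrow> ('a \<times> 'a \<Rightarrow>\<^sub>0 'k) set \<Rightarrow> ('a \<Rightarrow> 'k) \<Rightarrow> 'a" where
  "tensor_map s r u = the_elem (lin_ext s (\<lambda>(a, b). s (u a) b) ` r)"

text \<open>$(\mathrm{id} \otimes L(x) - R(x) \otimes \mathrm{id}) t = 0$ for all \<open>x\<close>.\<close>

definition invariant_tensor ::
  "('k::field \<Rightarrow> 'a::ring \<Rightarrow> 'a) \<Rightarrow> ('a \<times> 'a \<Rightarrow>\<^sub>0 'k) set \<Rightarrow> bool" where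
  "invariant_tensor s t \<longleftrightarrow>
     (\<forall>x. quot_map (rel2 s)
            (lin_ext free_scale (\<lambda>(a, b). gen (a, x * b) - gen (a * x, b))) t = rel2 s)"


section \<open>The generalized associative Yang--Baxter equation\<close>

text \<open>The bilinear extension, on the diagonal, of a map on pairs of generators:
  $\sum_i c_i x_i \mapsto \sum_{i,j} c_i c_j\, g(x_i, x_j)$.\<close>

definition quad_ext ::
  "('b \<Rightarrow> 'b \<Rightarrow> ('d \<Rightarrow>\<^sub>0 'k::field)) \<Rightarrow> ('b \<Rightarrow>\<^sub>0 'k) \<Rightarrow> ('d \<Rightarrow>\<^sub>0 'k)" where
  "quad_ext g p = lin_ext free_scale (\<lambda>x. lin_ext free_scale (\<lambda>y. g x y) p) p"

definition r12_r13 ::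
  "('k::field \<Rightarrow> 'a::ring \<Rightarrow> 'a) \<Rightarrow> ('a \<times> 'a \<Rightarrow>\<^sub>0 'k) set \<Rightarrow> ('a \<times> 'a \<times> 'a \<Rightarrow>\<^sub>0 'k) set" where
  "r12_r13 s =
     quot_map (rel3 s) (quad_ext (\<lambda>(a\<^sub>i, b\<^sub>i) (a\<^sub>j, b\<^sub>j). gen (a\<^sub>i * a\<^sub>j, b\<^sub>i, b\<^sub>j)))"

definition r13_r23 ::
  "('k::field \<Rightarrow> 'a::ring \<Rightarrow> 'a) \<Rightarrow> ('a \<times> 'a \<Rightarrow>\<^sub>0 'k) set \<Rightarrow> ('a \<times> 'a \<times> 'a \<Rightarrow>\<^sub>0 'k) set" where
  "r13_r23 s =
     quot_map (rel3 s) (quad_ext (\<lambda>(a\<^sub>i, b\<^sub>i) (a\<^sub>j, b\<^sub>j). gen (a\<^sub>i, a\<^sub>j, b\<^sub>i * b\<^sub>j)))"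

definition r23_r12 ::
  "('k::field \<Rightarrow> 'a::ring \<Rightarrow> 'a) \<Rightarrow> ('a \<times> 'a \<Rightarrow>\<^sub>0 'k) set \<Rightarrow> ('a \<times> 'a \<times> 'a \<Rightarrow>\<^sub>0 'k) set" where
  "r23_r12 s =
     quot_map (rel3 s) (quad_ext (\<lambda>(a\<^sub>i, b\<^sub>i) (a\<^sub>j, b\<^sub>j). gen (a\<^sub>i, a\<^sub>j * b\<^sub>i, b\<^sub>j)))"

definition GAYBE ::
  "('k::field \<Rightarrow> 'a::ring \<Rightarrow> 'a) \<Rightarrow> ('a \<times> 'a \<Rightarrow>\<^sub>0 'k) set \<Rightarrow> bool" where
  "GAYBE s r \<longleftrightarrow>
     (\<forall>x. quot_map (rel3 s)
            (lin_ext free_scale (\<lambda>(p, q, t). gen (p, q, x * t) - gen (p * x, q, t)))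
            (quot_diff (rel3 s) (quot_add (rel3 s) (r12_r13 s r) (r13_r23 s r)) (r23_r12 s r))
          = rel3 s)"


section \<open>Well-definedness\<close>

lemma vector_space_times: "vector_space ((*) :: 'k::field \<Rightarrow> 'k \<Rightarrow> 'k)"
  by unfold_locales (auto simp: algebra_simps)

lemma lookup_free_scale [simp]:
  "Poly_Mapping.lookup (free_scale c p) x = c * Poly_Mapping.lookup p x"
  by (simp add: free_scale_def map.rep_eq when_def)

interpretation free: vector_space "free_scale :: 'k::field \<Rightarrow> ('b \<Rightarrow>\<^sub>0 'k) \<Rightarrow> ('b \<Rightarrow>\<^sub>0 'k)"
  by unfold_locales (auto intro!: poly_mapping_eqI simp: lookup_add algebra_simps)

lemma free_scale_gen: "free_scale c (gen x) = Poly_Mapping.single x c"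
  by (rule poly_mapping_eqI) (simp add: lookup_single when_def)

lemma vector_space_fun_scale: "vector_space (fun_scale :: 'k::field \<Rightarrow> ('a \<Rightarrow> 'k) \<Rightarrow> _)"
  by unfold_locales (auto simp: fun_scale_def fun_eq_iff algebra_simps)

context vector_space
begin

lemma lin_ext_superset:
  assumes "finite S" "Poly_Mapping.keys p \<subseteq> S"
  shows "lin_ext scale f p = (\<Sum>x\<in>S. scale (Poly_Mapping.lookup p x) (f x))"
  unfolding lin_ext_def
  by (rule sum.mono_neutral_left) (use assms in \<open>auto simp: in_keys_iff\<close>)

lemma lin_ext_gen [simp]: "lin_ext scale f (gen x) = f x"
  by (simp add: lin_ext_def)

lemma lin_ext_add: "lin_ext scale f (p + q) = lin_ext scale f p + lin_ext scale f q"
proof -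
  let ?S = "Poly_Mapping.keys p \<union> Poly_Mapping.keys q"
  have "Poly_Mapping.keys (p + q) \<subseteq> ?S" by (rule Poly_Mapping.keys_add)
  then show ?thesis
    by (simp add: lin_ext_superset[of ?S] lookup_add scale_left_distrib sum.distrib)
qed

lemma lin_ext_scale: "lin_ext scale f (free_scale c p) = scale c (lin_ext scale f p)"
proof -
  have "Poly_Mapping.keys (free_scale c p) \<subseteq> Poly_Mapping.keys p"
    by (auto simp: in_keys_iff)
  then show ?thesis
    by (simp add: lin_ext_superset[of "Poly_Mapping.keys p"] scale_sum_right)
qed

lemma lin_ext_diff: "lin_ext scale f (p - q) = lin_ext scale f p - lin_ext scale f q"
  using lin_ext_add[of f "p - q" q] by simp

lemma lin_ext_0 [simp]: "lin_ext scale f 0 = 0"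
  by (simp add: lin_ext_def)

lemma lin_ext_add_fun: "lin_ext scale (\<lambda>x. f x + g x) p = lin_ext scale f p + lin_ext scale g p"
  by (simp add: lin_ext_def scale_right_distrib sum.distrib)

lemma lin_ext_diff_fun: "lin_ext scale (\<lambda>x. f x - g x) p = lin_ext scale f p - lin_ext scale g p"
  by (simp add: lin_ext_def scale_right_diff_distrib sum_subtractf)

lemma lin_ext_scale_fun: "lin_ext scale (\<lambda>x. scale c (f x)) p = scale c (lin_ext scale f p)"
  by (simp add: lin_ext_def scale_sum_right mult.commute)

lemma lin_ext_mem: "subspace N \<Longrightarrow> (\<And>x. f x \<in> N) \<Longrightarrow> lin_ext scale f p \<in> N"
  by (simp add: lin_ext_def subspace_sum subspace_scale)

lemma lin_ext_lin_ext:
  "lin_ext scale f (lin_ext free_scale g p) = lin_ext scale (\<lambda>x. lin_ext scale f (g x)) p"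
proof -
  have "lin_ext scale f (sum h S) = (\<Sum>x\<in>S. lin_ext scale f (h x))" for h and S :: "'d set"
    by (induction S rule: infinite_finite_induct) (simp_all add: lin_ext_add)
  then show ?thesis by (simp add: lin_ext_def[of free_scale] lin_ext_def[of _ _ p] lin_ext_scale)
qed

end

lemma lin_ext_free_gen: "lin_ext free_scale gen p = p"
proof (rule poly_mapping_eqI)
  fix x
  have "Poly_Mapping.lookup (lin_ext free_scale gen p) x =
      (\<Sum>y\<in>Poly_Mapping.keys p. if y = x then Poly_Mapping.lookup p y else 0)"
    by (simp add: lin_ext_def lookup_sum lookup_single when_def if_distrib cong: if_cong)
  then show "Poly_Mapping.lookup (lin_ext free_scale gen p) x = Poly_Mapping.lookup p x"
    by (simp add: in_keys_iff)
qed

text \<open>Every coset is the coset of any of its elements, so \<open>quot_map\<close>, \<open>quot_add\<close> and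
  \<open>quot_diff\<close> compute on representatives.\<close>

context module
begin

lemma coset_eq_iff: "subspace N \<Longrightarrow> coset N p = coset N q \<longleftrightarrow> p - q \<in> N"
proof
  assume N: "subspace N" and "coset N p = coset N q"
  moreover have "p \<in> coset N p" using N by (simp add: coset_def subspace_0)
  ultimately show "p - q \<in> N" by (simp add: coset_def)
next
  assume N: "subspace N" and pq: "p - q \<in> N"
  have "y - p \<in> N \<longleftrightarrow> y - q \<in> N" for y
    using subspace_add[OF N _ pq, of "y - p"] subspace_diff[OF N _ pq, of "y - q"] by auto
  then show "coset N p = coset N q" by (simp add: coset_def)
qed

lemma coset_eq_zero_iff: "subspace N \<Longrightarrow> coset N p = N \<longleftrightarrow> p \<in> N"
  using coset_eq_iff[of N p 0] by (simp add: coset_def)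

lemma quot_map_coset:
  assumes "subspace N" "0 \<in> M" "\<And>p q. q - p \<in> M \<Longrightarrow> F q - F p \<in> N"
  shows "quot_map N F (coset M p) = coset N (F p)"
proof -
  have "coset N (F q) = coset N (F p)" if "q \<in> coset M p" for q
    using that assms unfolding coset_eq_iff[OF assms(1)] by (simp add: coset_def)
  moreover have "p \<in> coset M p" using assms by (simp add: coset_def)
  ultimately show ?thesis unfolding quot_map_def by blast
qed

lemma quot_add_coset:
  assumes N: "subspace N"
  shows "quot_add N (coset N p) (coset N q) = coset N (p + q)"
proof -
  have "coset N (p' + q') = coset N (p + q)" if "p' \<in> coset N p" "q' \<in> coset N q" for p' q'
    using that subspace_add[OF N, of "p' - p" "q' - q"]
    unfolding coset_eq_iff[OF N] by (simp add: coset_def algebra_simps)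
  moreover have "p \<in> coset N p" "q \<in> coset N q" using N by (simp_all add: coset_def subspace_0)
  ultimately show ?thesis unfolding quot_add_def by blast
qed

lemma quot_diff_coset:
  assumes N: "subspace N"
  shows "quot_diff N (coset N p) (coset N q) = coset N (p - q)"
proof -
  have "coset N (p' - q') = coset N (p - q)" if "p' \<in> coset N p" "q' \<in> coset N q" for p' q'
    using that subspace_diff[OF N, of "p' - p" "q' - q"]
    unfolding coset_eq_iff[OF N] by (simp add: coset_def algebra_simps)
  moreover have "p \<in> coset N p" "q \<in> coset N q" using N by (simp_all add: coset_def subspace_0)
  ultimately show ?thesis unfolding quot_diff_def by blast
qed

end

lemma subspace_rel2 [simp]: "free.subspace (rel2 s)"
  and subspace_rel3 [simp]: "free.subspace (rel3 s)"
  by (simp_all add: rel2_def rel3_def)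

lemma zero_rel2 [simp]: "0 \<in> rel2 s"
  and zero_rel3 [simp]: "0 \<in> rel3 s"
  by (simp_all add: free.subspace_0)

text \<open>A linear map on the free space that is bilinear in the generators modulo \<open>N\<close> maps the
  relations into \<open>N\<close>.\<close>

lemma (in vector_space) lin_ext_rel2:
  assumes N: "subspace N" and p: "p \<in> rel2 s"
    and "\<And>a a' b. f (a + a', b) - f (a, b) - f (a', b) \<in> N"
    and "\<And>a b b'. f (a, b + b') - f (a, b) - f (a, b') \<in> N"
    and "\<And>c a b. f (s c a, b) - scale c (f (a, b)) \<in> N"
    and "\<And>c a b. f (a, s c b) - scale c (f (a, b)) \<in> N"
  shows "lin_ext scale f p \<in> N"
proof -
  have "free.subspace (lin_ext scale f -` N)"
    using N unfolding free.subspace_def subspace_def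
    by (auto simp: lin_ext_add lin_ext_scale)
  moreover have "rel2_gens s \<subseteq> lin_ext scale f -` N"
    using assms(3-) unfolding rel2_gens_def by (auto simp: lin_ext_diff lin_ext_scale)
  ultimately show ?thesis
    using p free.span_minimal unfolding rel2_def by blast
qed

lemma (in vector_space) lin_ext_rel3:
  assumes N: "subspace N" and p: "p \<in> rel3 s"
    and "\<And>a a' b d. f (a + a', b, d) - f (a, b, d) - f (a', b, d) \<in> N"
    and "\<And>a b b' d. f (a, b + b', d) - f (a, b, d) - f (a, b', d) \<in> N"
    and "\<And>a b d d'. f (a, b, d + d') - f (a, b, d) - f (a, b, d') \<in> N"
    and "\<And>c a b d. f (s c a, b, d) - scale c (f (a, b, d)) \<in> N"
    and "\<And>c a b d. f (a, s c b, d) - scale c (f (a, b, d)) \<in> N"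
    and "\<And>c a b d. f (a, b, s c d) - scale c (f (a, b, d)) \<in> N"
  shows "lin_ext scale f p \<in> N"
proof -
  have "free.subspace (lin_ext scale f -` N)"
    using N unfolding free.subspace_def subspace_def
    by (auto simp: lin_ext_add lin_ext_scale)
  moreover have "rel3_gens s \<subseteq> lin_ext scale f -` N"
    using assms(3-) unfolding rel3_gens_def by (auto simp: lin_ext_diff lin_ext_scale)
  ultimately show ?thesis
    using p free.span_minimal unfolding rel3_def by blast
qed

lemma rel2_mem:
  "gen (a + a', b) - gen (a, b) - gen (a', b) \<in> rel2 s"
  "gen (a, b + b') - gen (a, b) - gen (a, b') \<in> rel2 s"
  "gen (s c a, b) - free_scale c (gen (a, b)) \<in> rel2 s"
  "gen (a, s c b) - free_scale c (gen (a, b)) \<in> rel2 s"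
  unfolding rel2_def by (rule free.span_base, force simp: rel2_gens_def)+

lemma rel3_mem:
  "gen (a + a', b, d) - gen (a, b, d) - gen (a', b, d) \<in> rel3 s"
  "gen (a, b + b', d) - gen (a, b, d) - gen (a, b', d) \<in> rel3 s"
  "gen (a, b, d + d') - gen (a, b, d) - gen (a, b, d') \<in> rel3 s"
  "gen (s c a, b, d) - free_scale c (gen (a, b, d)) \<in> rel3 s"
  "gen (a, s c b, d) - free_scale c (gen (a, b, d)) \<in> rel3 s"
  "gen (a, b, s c d) - free_scale c (gen (a, b, d)) \<in> rel3 s"
  unfolding rel3_def by (rule free.span_base, force simp: rel3_gens_def)+

lemma scale2_coset: "scale2 s c (coset (rel2 s) p) = coset (rel2 s) (free_scale c p)"
  unfolding scale2_def
  by (rule free.quot_map_coset)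
     (auto simp: free.scale_right_diff_distrib[symmetric] intro: free.subspace_scale)

lemma flip_coset:
  "flip s (coset (rel2 s) p) =
     coset (rel2 s) (lin_ext free_scale (\<lambda>(a, b). gen (b, a)) p)"
  unfolding flip_def
  by (rule free.quot_map_coset)
     (auto simp: free.lin_ext_diff[symmetric] rel2_mem intro!: free.lin_ext_rel2)

lemma quad_ext_rel2:
  fixes s :: "'k::field \<Rightarrow> 'a::ring \<Rightarrow> 'a" and g :: "'a \<times> 'a \<Rightarrow> 'a \<times> 'a \<Rightarrow> ('a \<times> 'a \<times> 'a \<Rightarrow>\<^sub>0 'k)"
  assumes l1: "\<And>a a' b y. g (a + a', b) y - g (a, b) y - g (a', b) y \<in> rel3 s"
    and l2: "\<And>a b b' y. g (a, b + b') y - g (a, b) y - g (a, b') y \<in> rel3 s"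
    and l3: "\<And>c a b y. g (s c a, b) y - free_scale c (g (a, b) y) \<in> rel3 s"
    and l4: "\<And>c a b y. g (a, s c b) y - free_scale c (g (a, b) y) \<in> rel3 s"
    and r1: "\<And>x a a' b. g x (a + a', b) - g x (a, b) - g x (a', b) \<in> rel3 s"
    and r2: "\<And>x a b b'. g x (a, b + b') - g x (a, b) - g x (a, b') \<in> rel3 s"
    and r3: "\<And>x c a b. g x (s c a, b) - free_scale c (g x (a, b)) \<in> rel3 s"
    and r4: "\<And>x c a b. g x (a, s c b) - free_scale c (g x (a, b)) \<in> rel3 s"
  shows "quot_map (rel3 s) (quad_ext g) (coset (rel2 s) p) = coset (rel3 s) (quad_ext g p)"
proof (rule free.quot_map_coset)
  fix p q :: "'a \<times> 'a \<Rightarrow>\<^sub>0 'k" assume *: "q - p \<in> rel2 s"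
  let ?B = "\<lambda>p q. lin_ext free_scale (\<lambda>x. lin_ext free_scale (\<lambda>y. g x y) q) p"
  have 1: "?B (q - p) q \<in> rel3 s"
    by (rule free.lin_ext_rel2[OF _ *])
       (auto simp: free.lin_ext_diff_fun[symmetric] free.lin_ext_scale_fun[symmetric]
             intro!: free.lin_ext_mem l1 l2 l3 l4)
  have 2: "?B p (q - p) \<in> rel3 s"
    by (intro free.lin_ext_mem free.lin_ext_rel2[OF _ *] subspace_rel3 r1 r2 r3 r4)
  have "quad_ext g q - quad_ext g p = ?B (q - p) q + ?B p (q - p)"
    by (simp add: quad_ext_def free.lin_ext_diff free.lin_ext_diff_fun)
  with 1 2 show "quad_ext g q - quad_ext g p \<in> rel3 s"
    by (simp add: free.subspace_add)
qed simp_all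

context k_algebra
begin

lemma k_algebra_on_UNIV: "k_algebra_on scale UNIV (*)"
  unfolding k_algebra_on_def
  by (simp add: vector_space_axioms distrib_left distrib_right mult.assoc
      scale_mult_left scale_mult_right)

lemma r12_r13_coset:
  "r12_r13 scale (coset (rel2 scale) p) =
     coset (rel3 scale) (quad_ext (\<lambda>(a\<^sub>i, b\<^sub>i) (a\<^sub>j, b\<^sub>j). gen (a\<^sub>i * a\<^sub>j, b\<^sub>i, b\<^sub>j)) p)"
  unfolding r12_r13_def
  by (rule quad_ext_rel2)
     (auto simp: distrib_left distrib_right scale_mult_left scale_mult_right rel3_mem)

lemma r13_r23_coset:
  "r13_r23 scale (coset (rel2 scale) p) =
     coset (rel3 scale) (quad_ext (\<lambda>(a\<^sub>i, b\<^sub>i) (a\<^sub>j, b\<^sub>j). gen (a\<^sub>i, a\<^sub>j, b\<^sub>i * b\<^sub>j)) p)"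
  unfolding r13_r23_def
  by (rule quad_ext_rel2)
     (auto simp: distrib_left distrib_right scale_mult_left scale_mult_right rel3_mem)

lemma r23_r12_coset:
  "r23_r12 scale (coset (rel2 scale) p) =
     coset (rel3 scale) (quad_ext (\<lambda>(a\<^sub>i, b\<^sub>i) (a\<^sub>j, b\<^sub>j). gen (a\<^sub>i, a\<^sub>j * b\<^sub>i, b\<^sub>j)) p)"
  unfolding r23_r12_def
  by (rule quad_ext_rel2)
     (auto simp: distrib_left distrib_right scale_mult_left scale_mult_right rel3_mem)

lemma GAYBE_coset:
  "GAYBE scale (coset (rel2 scale) p) \<longleftrightarrow>
     (\<forall>x. lin_ext free_scale (\<lambda>(p, q, t). gen (p, q, x * t) - gen (p * x, q, t))
        (quad_ext (\<lambda>(a\<^sub>i, b\<^sub>i) (a\<^sub>j, b\<^sub>j). gen (a\<^sub>i * a\<^sub>j, b\<^sub>i, b\<^sub>j)) p +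
         quad_ext (\<lambda>(a\<^sub>i, b\<^sub>i) (a\<^sub>j, b\<^sub>j). gen (a\<^sub>i, a\<^sub>j, b\<^sub>i * b\<^sub>j)) p -
         quad_ext (\<lambda>(a\<^sub>i, b\<^sub>i) (a\<^sub>j, b\<^sub>j). gen (a\<^sub>i, a\<^sub>j * b\<^sub>i, b\<^sub>j)) p) \<in> rel3 scale)"
proof -
  have D: "(u - v) - (u' - v') - (u'' - v'') \<in> rel3 scale"
    if "u - u' - u'' \<in> rel3 scale" "v - v' - v'' \<in> rel3 scale"
    for u u' u'' v v' v'' :: "'a \<times> 'a \<times> 'a \<Rightarrow>\<^sub>0 'k"
    using free.subspace_diff[OF subspace_rel3 that] by (simp add: algebra_simps)
  have S: "(u - v) - free_scale c (u' - v') \<in> rel3 scale"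
    if "u - free_scale c u' \<in> rel3 scale" "v - free_scale c v' \<in> rel3 scale"
    for c and u u' v v' :: "'a \<times> 'a \<times> 'a \<Rightarrow>\<^sub>0 'k"
    using free.subspace_diff[OF subspace_rel3 that]
    by (simp add: free.scale_right_diff_distrib algebra_simps)
  have "lin_ext free_scale (\<lambda>(p, q, t). gen (p, q, x * t) - gen (p * x, q, t)) t \<in> rel3 scale"
    if "t \<in> rel3 scale" for x t
    using that
    by (rule free.lin_ext_rel3[OF subspace_rel3])
       (auto intro!: D S simp: distrib_left distrib_right scale_mult_left scale_mult_right rel3_mem)
  then show ?thesis
    unfolding GAYBE_def
    by (simp add: r12_r13_coset r13_r23_coset r23_r12_coset free.quot_add_coset
        free.quot_diff_coset free.quot_map_coset free.coset_eq_zero_iff free.lin_ext_diff[symmetric])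
qed

lemma dualD:
  assumes "u \<in> dual scale"
  shows "u (x + y) = u x + u y" "u (scale c x) = c * u x"
  using assms by (auto simp: dual_def Vector_Spaces.linear_iff)

lemma dualI:
  assumes "\<And>x y. u (x + y) = u x + u y" "\<And>c x. u (scale c x) = c * u x"
  shows "u \<in> dual scale"
  using assms
  by (auto simp: dual_def Vector_Spaces.linear_iff vector_space_axioms vector_space_times)

lemma tensor_map_coset:
  assumes u: "u \<in> dual scale"
  shows "tensor_map scale (coset (rel2 scale) p) u = lin_ext scale (\<lambda>(a, b). scale (u a) b) p"
proof -
  have "lin_ext scale (\<lambda>(a, b). scale (u a) b) q \<in> {0}" if "q \<in> rel2 scale" for q
    by (rule lin_ext_rel2[OF _ that])
       (auto simp: dualD[OF u] scale_left_distrib scale_right_distrib mult.commute)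
  then have "lin_ext scale (\<lambda>(a, b). scale (u a) b) q = lin_ext scale (\<lambda>(a, b). scale (u a) b) p"
    if "q \<in> coset (rel2 scale) p" for q
    using that by (force simp: coset_def lin_ext_diff)
  moreover have "p \<in> coset (rel2 scale) p"
    by (simp add: coset_def free.subspace_0)
  ultimately have "lin_ext scale (\<lambda>(a, b). scale (u a) b) ` coset (rel2 scale) p
      = {lin_ext scale (\<lambda>(a, b). scale (u a) b) p}"
    by blast
  then show ?thesis by (simp add: tensor_map_def)
qed

lemma tensor_map_flip:
  assumes "v \<in> dual scale"
  shows "tensor_map scale (flip scale (coset (rel2 scale) p)) v =
    lin_ext scale (\<lambda>(a, b). scale (v b) a) p"
  by (simp add: flip_coset tensor_map_coset[OF assms] lin_ext_lin_ext case_prod_unfold)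

lemma linear_on_dual_tensor_map:
  assumes "t \<in> tensor2 scale"
  shows "linear_on_dual scale (tensor_map scale t)"
proof -
  obtain p where t: "t = coset (rel2 scale) p" using assms by (auto simp: tensor2_def)
  have "u + v \<in> dual scale" "fun_scale c u \<in> dual scale" if "u \<in> dual scale" "v \<in> dual scale" for u v c
    by (rule dualI; use that in \<open>simp add: dualD fun_scale_def algebra_simps\<close>)+
  then show ?thesis
    by (auto simp: linear_on_dual_def t tensor_map_coset fun_scale_def case_prod_unfold
        scale_left_distrib lin_ext_add_fun lin_ext_scale_fun simp flip: scale_scale)
qed

lemma R_dual_in_dual: "u \<in> dual scale \<Longrightarrow> R_dual x u \<in> dual scale"
  and L_dual_in_dual: "u \<in> dual scale \<Longrightarrow> L_dual u x \<in> dual scale"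
  by (rule dualI; simp add: R_dual_def L_dual_def dualD algebra_simps scale_mult_left scale_mult_right)+

lemma gen_sum_left:
  "gen (\<Sum>i\<in>S. scale (c i) (v i), b) - (\<Sum>i\<in>S. free_scale (c i) (gen (v i, b))) \<in> rel2 scale"
proof (induction S rule: infinite_finite_induct)
  case (insert i S)
  let ?w = "\<Sum>i\<in>S. scale (c i) (v i)"
  have "gen (scale (c i) (v i) + ?w, b) - gen (scale (c i) (v i), b) - gen (?w, b) \<in> rel2 scale"
    "gen (scale (c i) (v i), b) - free_scale (c i) (gen (v i, b)) \<in> rel2 scale"
    by (rule rel2_mem)+
  from free.subspace_add[OF subspace_rel2 free.subspace_add[OF subspace_rel2 this] insert.IH] show ?case
    using insert.hyps by (simp add: algebra_simps)
qed (use rel2_mem(3)[where s=scale and c=0] in simp_all)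

lemma gen_sum_right:
  "gen (a, \<Sum>i\<in>S. scale (c i) (v i)) - (\<Sum>i\<in>S. free_scale (c i) (gen (a, v i))) \<in> rel2 scale"
proof (induction S rule: infinite_finite_induct)
  case (insert i S)
  let ?w = "\<Sum>i\<in>S. scale (c i) (v i)"
  have "gen (a, scale (c i) (v i) + ?w) - gen (a, scale (c i) (v i)) - gen (a, ?w) \<in> rel2 scale"
    "gen (a, scale (c i) (v i)) - free_scale (c i) (gen (a, v i)) \<in> rel2 scale"
    by (rule rel2_mem)+
  from free.subspace_add[OF subspace_rel2 free.subspace_add[OF subspace_rel2 this] insert.IH] show ?case
    using insert.hyps by (simp add: algebra_simps)
qed (use rel2_mem(4)[where s=scale and c=0] in simp_all)

end

context fd_k_algebra
begin

lemma obtain_basis: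
  obtains B where "finite B" "independent B" "span B = UNIV"
proof -
  obtain B where B: "finite B" "span B = UNIV" using finite_dim by blast
  obtain C where "C \<subseteq> B" "independent C" "B \<subseteq> span C"
    using maximal_independent_subset[of B] by blast
  moreover from this have "span B \<subseteq> span C" by (simp add: span_minimal)
  ultimately show thesis using B that[of C] by (metis finite_subset top.extremum_unique)
qed

lemma dual_separates:
  assumes "\<And>v. v \<in> dual scale \<Longrightarrow> v x = v y"
  shows "x = y"
proof -
  obtain B where B: "finite B" "independent B" "span B = UNIV" by (rule obtain_basis)
  have "representation B x b = representation B y b" for b
    using assms[of "\<lambda>x. representation B x b"] linear_representation[OF B(2,3)]
    by (simp add: dual_def)
  then have "representation B x = representation B y" by blast
  then show ?thesis
    by (metis B(2,3) UNIV_I sum_nonzero_representation_eq)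
qed

lemma rel2_iff:
  "p \<in> rel2 scale \<longleftrightarrow> (\<forall>u\<in>dual scale. lin_ext scale (\<lambda>(a, b). scale (u a) b) p = 0)"
proof
  assume "p \<in> rel2 scale"
  then have "coset (rel2 scale) p = coset (rel2 scale) 0" by (simp add: free.coset_eq_iff)
  then show "\<forall>u\<in>dual scale. lin_ext scale (\<lambda>(a, b). scale (u a) b) p = 0"
    using tensor_map_coset by (metis lin_ext_0)
next
  assume *: "\<forall>u\<in>dual scale. lin_ext scale (\<lambda>(a, b). scale (u a) b) p = 0"
  obtain B where B: "finite B" "independent B" "span B = UNIV" by (rule obtain_basis)
  define co where "co b x = representation B x b" for b x
  have co: "co b \<in> dual scale" for b
    using linear_representation[OF B(2,3)] by (simp add: dual_def co_def[abs_def])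
  have exp: "(\<Sum>b\<in>B. scale (co b x) b) = x" for x
    unfolding co_def using B by (intro sum_representation_eq) auto
  let ?G = "\<lambda>b x. gen (b, scale (co b (fst x)) (snd x))"
  have 1: "lin_ext free_scale (?G b) p \<in> rel2 scale" for b
  proof -
    have "(\<Sum>x\<in>Poly_Mapping.keys p. scale (Poly_Mapping.lookup p x) (scale (co b (fst x)) (snd x))) = 0"
      using * co[of b] by (simp add: lin_ext_def case_prod_unfold)
    with gen_sum_right[of b "Poly_Mapping.lookup p" "\<lambda>x. scale (co b (fst x)) (snd x)" "Poly_Mapping.keys p"]
    have "gen (b, 0) - lin_ext free_scale (?G b) p \<in> rel2 scale"
      by (simp add: lin_ext_def)
    from free.subspace_diff[OF subspace_rel2 rel2_mem(4)[where s=scale and c=0 and a=b and b=0] this]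
    show ?thesis by simp
  qed
  have 2: "gen x - (\<Sum>b\<in>B. ?G b x) \<in> rel2 scale" for x
  proof -
    have "gen (fst x, snd x) - (\<Sum>b\<in>B. free_scale (co b (fst x)) (gen (b, snd x))) \<in> rel2 scale"
      using gen_sum_left[of "\<lambda>b. co b (fst x)" "\<lambda>b. b" B "snd x"] by (simp add: exp)
    moreover have "(\<Sum>b\<in>B. ?G b x - free_scale (co b (fst x)) (gen (b, snd x))) \<in> rel2 scale"
      by (intro free.subspace_sum subspace_rel2 rel2_mem)
    ultimately show ?thesis
      using free.subspace_diff[OF subspace_rel2] by (fastforce simp: sum_subtractf)
  qed
  have "lin_ext free_scale (\<lambda>x. gen x - (\<Sum>b\<in>B. ?G b x)) p \<in> rel2 scale"
    by (intro free.lin_ext_mem subspace_rel2 2)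
  moreover have "lin_ext free_scale (\<lambda>x. \<Sum>b\<in>B. ?G b x) p = (\<Sum>b\<in>B. lin_ext free_scale (?G b) p)"
    by (simp add: lin_ext_def free.scale_sum_right sum.swap[of _ B])
  then have "lin_ext free_scale (\<lambda>x. \<Sum>b\<in>B. ?G b x) p \<in> rel2 scale"
    using 1 by (simp add: free.subspace_sum)
  ultimately have "lin_ext free_scale gen p \<in> rel2 scale"
    using free.subspace_add[OF subspace_rel2] by (fastforce simp: free.lin_ext_diff_fun)
  then show "p \<in> rel2 scale" by (simp add: lin_ext_free_gen)
qed

text \<open>For a symmetric tensor, invariance is the same as being a balanced bimodule
  homomorphism; by the second lemma this applies to the symmetric part of any tensor.\<close>

lemma balanced_iff_invariant:
  assumes t: "t \<in> tensor2 scale" and sym: "flip scale t = t"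
  shows "balanced_bimodule_hom scale (tensor_map scale t) \<longleftrightarrow> invariant_tensor scale t"
proof -
  obtain p where p: "t = coset (rel2 scale) p" using t by (auto simp: tensor2_def)
  let ?\<beta> = "tensor_map scale t"
  let ?J = "\<lambda>x. lin_ext free_scale (\<lambda>(a, b). gen (a, x * b) - gen (a * x, b))"
  have \<beta>: "?\<beta> u = lin_ext scale (\<lambda>(a, b). scale (u a) b) p" if "u \<in> dual scale" for u
    using tensor_map_coset[OF that] p by simp
  have mult: "x * lin_ext scale f q = lin_ext scale (\<lambda>y. x * f y) q" for x f and q :: "'a \<times> 'a \<Rightarrow>\<^sub>0 'k"
    by (simp add: lin_ext_def sum_distrib_left scale_mult_right)
  have ev: "lin_ext scale (\<lambda>(a, b). scale (u a) b) (?J x q) =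
      x * lin_ext scale (\<lambda>(a, b). scale (u a) b) q - lin_ext scale (\<lambda>(a, b). scale (R_dual x u a) b) q" for u x q
    by (simp add: lin_ext_lin_ext lin_ext_diff case_prod_unfold mult scale_mult_right
        lin_ext_diff_fun[symmetric] R_dual_def)
  have "?J x q \<in> rel2 scale" if "q \<in> rel2 scale" for x q
    using that by (auto simp: rel2_iff ev R_dual_in_dual)
  then have "invariant_tensor scale t \<longleftrightarrow> (\<forall>x. ?J x p \<in> rel2 scale)"
    unfolding invariant_tensor_def p
    by (simp add: free.quot_map_coset free.coset_eq_zero_iff free.lin_ext_diff[symmetric])
  also have "\<dots> \<longleftrightarrow> (\<forall>x. \<forall>u\<in>dual scale. ?\<beta> (R_dual x u) = x * ?\<beta> u)"
    by (auto simp: rel2_iff ev R_dual_in_dual \<beta>)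
  finally have inv: "invariant_tensor scale t \<longleftrightarrow> (\<forall>x. \<forall>u\<in>dual scale. ?\<beta> (R_dual x u) = x * ?\<beta> u)" .
  have \<beta>_sym: "v (?\<beta> u) = u (?\<beta> v)" if u: "u \<in> dual scale" and v: "v \<in> dual scale" for u v
  proof -
    have *: "w (lin_ext scale f p) = (\<Sum>x\<in>Poly_Mapping.keys p. Poly_Mapping.lookup p x * w (f x))"
      if w: "w \<in> dual scale" for w f
    proof -
      have "w 0 = 0" using dualD(2)[OF w, of 0 0] by simp
      then have "w (sum h S) = (\<Sum>x\<in>S. w (h x))" for h and S :: "('a \<times> 'a) set"
        by (induction S rule: infinite_finite_induct) (simp_all add: dualD[OF w])
      then show ?thesis by (simp add: lin_ext_def dualD[OF w])
    qed
    have "?\<beta> v = lin_ext scale (\<lambda>(a, b). scale (v b) a) p"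
      using tensor_map_flip[OF v, of p] sym p by simp
    then show ?thesis
      by (simp add: \<beta>[OF u] * u v case_prod_unfold dualD mult.commute mult.left_commute)
  qed
  show ?thesis
  proof
    assume "balanced_bimodule_hom scale ?\<beta>"
    then show "invariant_tensor scale t" unfolding inv balanced_bimodule_hom_def by blast
  next
    assume "invariant_tensor scale t"
    then have R: "?\<beta> (R_dual x u) = x * ?\<beta> u" if "u \<in> dual scale" for x u using that inv by blast
    have "?\<beta> (L_dual u x) = ?\<beta> u * x" if u: "u \<in> dual scale" for u x
    proof (rule dual_separates)
      fix v assume v: "v \<in> dual scale"
      have "v (?\<beta> (L_dual u x)) = u (?\<beta> (R_dual x v))"
        using \<beta>_sym[OF L_dual_in_dual[OF u] v] by (simp add: L_dual_def R[OF v])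
      also have "\<dots> = v (?\<beta> u * x)"
        using \<beta>_sym[OF R_dual_in_dual[OF v] u] by (simp add: R_dual_def)
      finally show "v (?\<beta> (L_dual u x)) = v (?\<beta> u * x)" .
    qed
    moreover have "R_dual (?\<beta> u) v = L_dual u (?\<beta> v)" if u: "u \<in> dual scale" and v: "v \<in> dual scale" for u v
    proof
      fix y
      show "R_dual (?\<beta> u) v y = L_dual u (?\<beta> v) y"
        using \<beta>_sym[OF R_dual_in_dual[OF u] v, of y] R[OF u, of y] by (simp add: R_dual_def L_dual_def)
    qed
    ultimately show "balanced_bimodule_hom scale ?\<beta>"
      unfolding balanced_bimodule_hom_def using linear_on_dual_tensor_map[OF t] R by blast
  qed
qed

lemma symmetric_part:
  assumes "r \<in> tensor2 scale" and "\<beta> = scale2 scale c (quot_add (rel2 scale) r (flip scale r))"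
  shows "\<beta> \<in> tensor2 scale" "flip scale \<beta> = \<beta>"
  using assms
  by (auto simp: tensor2_def flip_coset scale2_coset free.quot_add_coset free.lin_ext_scale
      free.lin_ext_add free.lin_ext_lin_ext case_prod_unfold lin_ext_free_gen add.commute)

end

end

theory Submission
  imports Defs
begin

text \<open>Write \<open>\<rho> = r\<close> and \<open>\<sigma> = -r\<^sup>t\<close> for the maps on the dual space, so that
  \<open>\<rho> = \<alpha> + \<beta>\<close>, \<open>\<sigma> = \<alpha> - \<beta>\<close> and \<open>u * v = R\<^sup>*(\<rho> u) v + u L\<^sup>*(\<sigma> v)\<close>. As \<open>\<beta>\<close> is balanced, this
  product equals \<open>R\<^sup>*(\<alpha> u) v + u L\<^sup>*(\<alpha> v)\<close>, and as \<open>\<beta>\<close> is a bimodule homomorphism, \<open>\<rho>\<close> and \<open>\<sigma>\<close>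
  have the same multiplicativity defect
  \<open>\<rho> u \<rho> v - \<rho> (u * v) = (\<kappa> + 1) \<beta> u \<beta> v = \<sigma> u \<sigma> v - \<sigma> (u * v)\<close>.
  The associator of \<open>*\<close> is \<open>\<kappa> + 1\<close> times \<open>u L\<^sup>*(\<beta> v \<beta> w) - R\<^sup>*(\<beta> u \<beta> v) w\<close>, which vanishes
  because \<open>\<beta>\<close> is balanced. Contracting \<open>r\<^sub>1\<^sub>2 r\<^sub>1\<^sub>3 + r\<^sub>1\<^sub>3 r\<^sub>2\<^sub>3 - r\<^sub>2\<^sub>3 r\<^sub>1\<^sub>2\<close> with \<open>u \<otimes> v\<close> in the first two
  factors gives the defect of \<open>\<rho>\<close>; the GAYBE then says that
  \<open>x \<beta> u \<beta> v = \<beta> (R\<^sup>*(x) u) \<beta> v\<close>, up to the factor \<open>\<kappa> + 1\<close>.\<close>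

section \<open>Formal sums modulo a subspace\<close>

text \<open>One induction serves every slot of \<open>gen\<close>: take for \<open>h\<close> the
  insertion of a vector into that slot and for \<open>N\<close> the subspace
  \<open>rel3 s\<close>.\<close>

lemma linear_sum_mod_subspace:
  fixes s :: "'k::field \<Rightarrow> 'a::ab_group_add \<Rightarrow> 'a" and h :: "'a \<Rightarrow> 'b \<Rightarrow>\<^sub>0 'k"
  assumes N: "free.subspace N" and s0: "s 0 0 = 0"
    and add: "\<And>x y. h (x + y) - h x - h y \<in> N"
    and scale: "\<And>c x. h (s c x) - free_scale c (h x) \<in> N"
  shows "h (\<Sum>i\<in>S. s (c i) (v i)) - (\<Sum>i\<in>S. free_scale (c i) (h (v i))) \<in> N"
proof (induction S rule: infinite_finite_induct)
  case (insert i S)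
  let ?w = "\<Sum>i\<in>S. s (c i) (v i)"
  have "h (s (c i) (v i) + ?w) - h (s (c i) (v i)) - h ?w \<in> N"
    "h (s (c i) (v i)) - free_scale (c i) (h (v i)) \<in> N"
    by (rule add scale)+
  from free.subspace_add[OF N free.subspace_add[OF N this] insert.IH] show ?case
    using insert.hyps by (simp add: algebra_simps)
\<comment> \<open>An empty sum requires \<open>h 0\<close> to lie in \<open>N\<close>; this is
  homogeneity for the scalar 0 at the vector 0.\<close>
qed (use scale[of 0 0] s0 in simp_all)

lemma (in vector_space) lin_ext_sum_fun:
  "lin_ext scale (\<lambda>x. \<Sum>i\<in>S. f i x) p = (\<Sum>i\<in>S. lin_ext scale (f i) p)"
  by (simp only: lin_ext_def scale_sum_right) (rule sum.swap)

text \<open>\<open>quad_ext\<close> sums over \<open>i\<close> outside and \<open>j\<close> inside,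
  while applying \<open>r\<close> after an inner contraction nests the sums the other way
  round.\<close>

lemma (in vector_space) lin_ext_swap:
  "lin_ext scale (\<lambda>x. lin_ext scale (f x) q) p = lin_ext scale (\<lambda>y. lin_ext scale (\<lambda>x. f x y) p) q"
  unfolding lin_ext_def scale_sum_right
  by (subst sum.swap) (simp only: scale_scale mult.commute)

section \<open>The dual space as a bimodule\<close>

context k_algebra
begin

lemma dual_zero: "u \<in> dual scale \<Longrightarrow> u 0 = 0"
  using dualD(2)[of u 0 0] by simp

lemma dual_uminus: "u \<in> dual scale \<Longrightarrow> u (- x) = - u x"
  using dualD(1)[of u x "- x"] dual_zero[of u] by (simp add: eq_neg_iff_add_eq_0 add.commute)

lemma dual_diff: "u \<in> dual scale \<Longrightarrow> u (x - y) = u x - u y"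
  using dualD(1)[of u x "- y"] by (simp add: dual_uminus)

lemma dual_lin_ext:
  assumes u: "u \<in> dual scale"
  shows "u (lin_ext scale f p) = lin_ext (*) (\<lambda>x. u (f x)) p"
proof -
  have "u (sum h S) = (\<Sum>x\<in>S. u (h x))" for h and S :: "'b set"
    by (induction S rule: infinite_finite_induct) (simp_all add: dualD[OF u] dual_zero[OF u])
  then show ?thesis by (simp add: lin_ext_def dualD[OF u])
qed

lemma lin_ext_times_left: "x * lin_ext scale f p = lin_ext scale (\<lambda>y. x * f y) p"
  by (simp add: lin_ext_def sum_distrib_left scale_mult_right)

lemma lin_ext_times_right: "lin_ext scale f p * x = lin_ext scale (\<lambda>y. f y * x) p"
  by (simp add: lin_ext_def sum_distrib_right scale_mult_left)

lemma scale_lin_ext: "scale (lin_ext (*) f p) x = lin_ext scale (\<lambda>y. scale (f y) x) p"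
  by (simp add: lin_ext_def scale_sum_left)

lemma subspace_dual: "module.subspace fun_scale (dual scale)"
proof -
  interpret F: vector_space "fun_scale :: 'k \<Rightarrow> ('a \<Rightarrow> 'k) \<Rightarrow> _" by (rule vector_space_fun_scale)
  show ?thesis
    by (rule F.subspaceI; rule dualI) (auto simp: dualD fun_scale_def algebra_simps)
qed

lemma dual_closed:
  assumes "u \<in> dual scale" "v \<in> dual scale"
  shows "u + v \<in> dual scale" "u - v \<in> dual scale" "fun_scale c u \<in> dual scale"
  by (rule dualI; use assms in \<open>simp add: dualD fun_scale_def algebra_simps\<close>)+

lemma R_dual_add: "u \<in> dual scale \<Longrightarrow> R_dual (x + y) u = R_dual x u + R_dual y u"
  and R_dual_diff: "u \<in> dual scale \<Longrightarrow> R_dual (x - y) u = R_dual x u - R_dual y u"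
  and R_dual_scale: "u \<in> dual scale \<Longrightarrow> R_dual (scale c x) u = fun_scale c (R_dual x u)"
  and L_dual_add: "u \<in> dual scale \<Longrightarrow> L_dual u (x + y) = L_dual u x + L_dual u y"
  and L_dual_diff: "u \<in> dual scale \<Longrightarrow> L_dual u (x - y) = L_dual u x - L_dual u y"
  and L_dual_scale: "u \<in> dual scale \<Longrightarrow> L_dual u (scale c x) = fun_scale c (L_dual u x)"
  by (simp_all add: R_dual_def L_dual_def fun_scale_def fun_eq_iff dualD dual_diff
      distrib_left distrib_right left_diff_distrib right_diff_distrib scale_mult_left scale_mult_right)

text \<open>The bimodule axioms: a left action, a right action, and their commuting.\<close>

lemma R_dual_times: "R_dual (x * y) u = R_dual x (R_dual y u)"
  and L_dual_times: "L_dual u (x * y) = L_dual (L_dual u x) y"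
  and R_dual_L_dual: "R_dual x (L_dual u y) = L_dual (R_dual x u) y"
  by (simp_all add: R_dual_def L_dual_def mult.assoc)

section \<open>The product on the dual space\<close>

text \<open>Since \<beta> respects both actions, \<open>\<beta> m\<close> is the sum of the mixed
  terms and cancels them for either sign. There remain \<kappa> times
  \<open>\<beta> u * \<beta> v\<close> from \<alpha>, and \<open>\<beta> u * \<beta> v\<close>
  itself, which is even in \<beta>.\<close>

lemma O_operator_defect:
  assumes bal: "balanced_bimodule_hom scale \<beta>" and ext: "extended_O_operator scale \<alpha> \<beta> \<kappa>"
    and u: "u \<in> dual scale" and v: "v \<in> dual scale"
  defines "m \<equiv> R_dual (\<alpha> u) v + L_dual u (\<alpha> v)"
  shows "(\<alpha> u + \<beta> u) * (\<alpha> v + \<beta> v) - (\<alpha> m + \<beta> m) = scale (\<kappa> + 1) (\<beta> u * \<beta> v)"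
    and "(\<alpha> u - \<beta> u) * (\<alpha> v - \<beta> v) - (\<alpha> m - \<beta> m) = scale (\<kappa> + 1) (\<beta> u * \<beta> v)"
proof -
  have "\<beta> m = \<alpha> u * \<beta> v + \<beta> u * \<alpha> v"
    using bal u v by (simp add: m_def balanced_bimodule_hom_def linear_on_dual_def
        R_dual_in_dual L_dual_in_dual)
  moreover have "\<alpha> u * \<alpha> v - \<alpha> m = scale \<kappa> (\<beta> u * \<beta> v)"
    using ext u v by (simp add: m_def extended_O_operator_def)
  then have "\<alpha> m = \<alpha> u * \<alpha> v - scale \<kappa> (\<beta> u * \<beta> v)"
    by (simp add: algebra_simps)
  ultimately show "(\<alpha> u + \<beta> u) * (\<alpha> v + \<beta> v) - (\<alpha> m + \<beta> m) = scale (\<kappa> + 1) (\<beta> u * \<beta> v)"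
    and "(\<alpha> u - \<beta> u) * (\<alpha> v - \<beta> v) - (\<alpha> m - \<beta> m) = scale (\<kappa> + 1) (\<beta> u * \<beta> v)"
    by (simp_all add: algebra_simps)
qed

lemma balanced_product_eq:
  assumes bal: "balanced_bimodule_hom scale \<beta>" and u: "u \<in> dual scale" and v: "v \<in> dual scale"
  shows "R_dual (\<alpha> u + \<beta> u) v + L_dual u (\<alpha> v - \<beta> v) = R_dual (\<alpha> u) v + L_dual u (\<alpha> v)"
  using assms by (simp add: balanced_bimodule_hom_def R_dual_add L_dual_diff)

text \<open>Balance is used for \<open>v\<close>, \<open>w\<close> and then for \<open>u\<close>,
  \<open>v\<close>; in between, the two actions are exchanged.\<close>

lemma balanced_times:
  assumes bal: "balanced_bimodule_hom scale \<beta>"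
    and u: "u \<in> dual scale" and v: "v \<in> dual scale" and w: "w \<in> dual scale"
  shows "R_dual (\<beta> u * \<beta> v) w = L_dual u (\<beta> v * \<beta> w)"
  using assms by (simp add: balanced_bimodule_hom_def R_dual_times L_dual_times R_dual_L_dual)

lemma k_algebra_on_dual:
  assumes bal: "balanced_bimodule_hom scale \<beta>" and ext: "extended_O_operator scale \<alpha> \<beta> \<kappa>"
    and m: "\<And>u v. u \<in> dual scale \<Longrightarrow> v \<in> dual scale \<Longrightarrow>
      m u v = R_dual (\<alpha> u + \<beta> u) v + L_dual u (\<alpha> v - \<beta> v)"
  shows "k_algebra_on fun_scale (dual scale) m"
proof -
  \<comment> \<open>Closure and bilinearity are read off this form. Associativity uses the form with
    \<open>\<alpha> + \<beta>\<close> and \<open>\<alpha> - \<beta>\<close>, whose defects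
    agree.\<close>
  let ?m = "\<lambda>u v. R_dual (\<alpha> u) v + L_dual u (\<alpha> v)"
  have m': "m u v = ?m u v" if "u \<in> dual scale" "v \<in> dual scale" for u v
    using that by (simp add: m balanced_product_eq[OF bal])
  have closed: "?m u v \<in> dual scale" if "u \<in> dual scale" "v \<in> dual scale" for u v
    using that by (simp add: dual_closed R_dual_in_dual L_dual_in_dual)
  have \<alpha>: "\<alpha> (u + v) = \<alpha> u + \<alpha> v" "\<alpha> (fun_scale c u) = scale c (\<alpha> u)"
    if "u \<in> dual scale" "v \<in> dual scale" for u v c
    using ext that by (simp_all add: extended_O_operator_def linear_on_dual_def)
  have assoc: "m (m u v) w = m u (m v w)"
    if u: "u \<in> dual scale" and v: "v \<in> dual scale" and w: "w \<in> dual scale" for u v w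
  proof -
    let ?\<rho> = "\<lambda>u. \<alpha> u + \<beta> u" and ?\<sigma> = "\<lambda>u. \<alpha> u - \<beta> u"
    note mem = u v w R_dual_in_dual L_dual_in_dual
    have uv: "m u v \<in> dual scale" and vw: "m v w \<in> dual scale" using u v w m' closed by simp_all
    have \<rho>: "?\<rho> (m u v) = ?\<rho> u * ?\<rho> v - scale (\<kappa> + 1) (\<beta> u * \<beta> v)"
      using O_operator_defect(1)[OF bal ext u v] m'[OF u v] by (simp add: algebra_simps)
    have \<sigma>: "?\<sigma> (m v w) = ?\<sigma> v * ?\<sigma> w - scale (\<kappa> + 1) (\<beta> v * \<beta> w)"
      using O_operator_defect(2)[OF bal ext v w] m'[OF v w] by (simp add: algebra_simps)
    have "m (m u v) w = R_dual (?\<rho> (m u v)) w + L_dual (m u v) (?\<sigma> w)"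
      by (rule m[OF uv w])
    \<comment> \<open>\<open>balanced_times\<close> turns the defect of \<open>?\<rho>\<close>
      acting on \<open>w\<close> into a term acting on \<open>u\<close>, which the next step absorbs
      as the defect of \<open>?\<sigma>\<close>. Unfolding \<open>m\<close> must wait until
      \<open>?\<rho> (m u v)\<close> has been rewritten.\<close>
    also have "\<dots> = R_dual (?\<rho> u * ?\<rho> v) w - fun_scale (\<kappa> + 1) (L_dual u (\<beta> v * \<beta> w))
        + L_dual (R_dual (?\<rho> u) v) (?\<sigma> w) + L_dual u (?\<sigma> v * ?\<sigma> w)"
      unfolding \<rho> R_dual_diff[OF w] R_dual_scale[OF w] balanced_times[OF bal u v w]
      unfolding m[OF u v]
      by (simp add: L_dual_def fun_eq_iff mult.assoc)
    also have "\<dots> = R_dual (?\<rho> u) (m v w) + L_dual u (?\<sigma> (m v w))"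
      unfolding \<sigma> L_dual_diff[OF u] L_dual_scale[OF u]
      unfolding m[OF v w]
      by (simp add: L_dual_def R_dual_def fun_eq_iff mult.assoc)
    also have "\<dots> = m u (m v w)"
      by (rule m[OF u vw, symmetric])
    finally show ?thesis .
  qed
  have "m (u + v) w = m u w + m v w" "m u (v + w) = m u v + m u w"
    "m (fun_scale c u) v = fun_scale c (m u v)" "m u (fun_scale c v) = fun_scale c (m u v)"
    if "u \<in> dual scale" "v \<in> dual scale" "w \<in> dual scale" for u v w c
    using that
    by (simp_all add: m' dual_closed \<alpha> R_dual_add L_dual_add R_dual_scale L_dual_scale)
       (simp_all add: R_dual_def L_dual_def fun_scale_def fun_eq_iff algebra_simps)
  with assoc show ?thesis
    unfolding k_algebra_on_def
    by (simp add: vector_space_fun_scale subspace_dual m' closed)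
qed

end

section \<open>Contractions of the tensor cube\<close>

context fd_k_algebra
begin

text \<open>Expanding the first two factors in a finite basis writes \<open>p\<close>, modulo
  \<open>rel3\<close>, as a sum of tensors of two basis vectors with a contraction of
  \<open>p\<close>.\<close>

lemma rel3_mem_if_contractions_zero:
  assumes *: "\<And>u v. u \<in> dual scale \<Longrightarrow> v \<in> dual scale \<Longrightarrow>
      lin_ext scale (\<lambda>(a, b, d). scale (u a * v b) d) p = 0"
  shows "p \<in> rel3 scale"
proof -
  obtain B where B: "finite B" "independent B" "span B = UNIV" by (rule obtain_basis)
  \<comment> \<open>The coordinate functionals, that is, the dual basis.\<close>
  define co where "co b x = representation B x b" for b x
  have co: "co b \<in> dual scale" for b
    using linear_representation[OF B(2,3)] by (simp add: dual_def co_def[abs_def])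
  have exp: "(\<Sum>b\<in>B. scale (co b x) b) = x" for x
    unfolding co_def using B by (intro sum_representation_eq) auto
  note sum_mod = linear_sum_mod_subspace[where s = scale, OF subspace_rel3, OF scale_zero_left]
  let ?h = "\<lambda>b c x. scale (co b (fst x) * co c (fst (snd x))) (snd (snd x))"
  let ?G = "\<lambda>b c x. gen (b, c, ?h b c x)"
  have 1: "lin_ext free_scale (?G b c) p \<in> rel3 scale" for b c
  proof -
    have "lin_ext scale (?h b c) p = 0"
      using *[OF co co] by (simp add: case_prod_unfold)
    moreover have "gen (b, c, lin_ext scale (?h b c) p) - lin_ext free_scale (?G b c) p \<in> rel3 scale"
      unfolding lin_ext_def by (rule sum_mod) (rule rel3_mem)+
    moreover have "gen (b, c, 0) \<in> rel3 scale"
      using rel3_mem(6)[where s=scale and c=0 and d=0] by simp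
    ultimately show ?thesis
      using free.subspace_diff[OF subspace_rel3] by fastforce
  qed
  have 2: "gen x - (\<Sum>b\<in>B. \<Sum>c\<in>B. ?G b c x) \<in> rel3 scale" for x
  proof -
    obtain a a' d where x: "x = (a, a', d)" by (cases x)
    have s1: "gen (a, a', d) - (\<Sum>b\<in>B. free_scale (co b a) (gen (b, a', d))) \<in> rel3 scale"
      using sum_mod[where h = "\<lambda>y. gen (y, a', d)" and c = "\<lambda>b. co b a" and v = "\<lambda>b. b" and S = B]
      by (simp add: rel3_mem exp)
    have s2: "gen (b, a', d) - (\<Sum>c\<in>B. free_scale (co c a') (gen (b, c, d))) \<in> rel3 scale" for b
      using sum_mod[where h = "\<lambda>y. gen (b, y, d)" and c = "\<lambda>c. co c a'" and v = "\<lambda>b. b" and S = B]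
      by (simp add: rel3_mem exp)
    have s3: "free_scale (co b a * co c a') (gen (b, c, d)) - ?G b c x \<in> rel3 scale" for b c
      using free.subspace_neg[OF subspace_rel3, OF rel3_mem(6)] by (simp add: x)
    have "(\<Sum>b\<in>B. free_scale (co b a) (gen (b, a', d) - (\<Sum>c\<in>B. free_scale (co c a') (gen (b, c, d)))))
        \<in> rel3 scale"
      by (intro free.subspace_sum free.subspace_scale subspace_rel3 s2)
    moreover have "(\<Sum>b\<in>B. \<Sum>c\<in>B. free_scale (co b a * co c a') (gen (b, c, d)) - ?G b c x) \<in> rel3 scale"
      by (intro free.subspace_sum subspace_rel3 s3)
    \<comment> \<open>A telescoping sum: expand the first slot, then the second, then move both
      coefficients into the third.\<close>
    ultimately have "(gen (a, a', d) - (\<Sum>b\<in>B. free_scale (co b a) (gen (b, a', d)))) +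
       ((\<Sum>b\<in>B. free_scale (co b a) (gen (b, a', d) - (\<Sum>c\<in>B. free_scale (co c a') (gen (b, c, d))))) +
        (\<Sum>b\<in>B. \<Sum>c\<in>B. free_scale (co b a * co c a') (gen (b, c, d)) - ?G b c x)) \<in> rel3 scale"
      using s1 by (intro free.subspace_add subspace_rel3)
    then show ?thesis
      by (simp add: x sum_subtractf free.scale_right_diff_distrib free.scale_sum_right)
  qed
  have "lin_ext free_scale (\<lambda>x. gen x - (\<Sum>b\<in>B. \<Sum>c\<in>B. ?G b c x)) p \<in> rel3 scale"
    by (intro free.lin_ext_mem subspace_rel3 2)
  moreover have "lin_ext free_scale (\<lambda>x. \<Sum>b\<in>B. \<Sum>c\<in>B. ?G b c x) p
      = (\<Sum>b\<in>B. \<Sum>c\<in>B. lin_ext free_scale (?G b c) p)"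
    by (simp add: free.lin_ext_sum_fun)
  then have "lin_ext free_scale (\<lambda>x. \<Sum>b\<in>B. \<Sum>c\<in>B. ?G b c x) p \<in> rel3 scale"
    using 1 by (simp add: free.subspace_sum)
  ultimately have "lin_ext free_scale gen p \<in> rel3 scale"
    using free.subspace_add[OF subspace_rel3] by (fastforce simp: free.lin_ext_diff_fun)
  then show "p \<in> rel3 scale" by (simp add: lin_ext_free_gen)
qed

text \<open>Under contraction with \<open>u\<close> and \<open>v\<close>, \<open>L(x)\<close> on the
  third factor becomes left multiplication by \<open>x\<close>, and \<open>R(x)\<close> on the first
  replaces \<open>u\<close> by \<open>R_dual x u\<close>.\<close>

lemma GAYBE_if_defect_invariant:
  assumes r: "r \<in> tensor2 scale"
  defines "E \<equiv> \<lambda>u v. tensor_map scale r u * tensor_map scale r v - tensor_map scale r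
      (R_dual (tensor_map scale r u) v - L_dual u (tensor_map scale (flip scale r) v))"
  assumes inv: "\<And>x u v. u \<in> dual scale \<Longrightarrow> v \<in> dual scale \<Longrightarrow> x * E u v = E (R_dual x u) v"
  shows "GAYBE scale r"
proof -
  obtain p where p: "r = coset (rel2 scale) p" using r by (auto simp: tensor2_def)
  let ?T = "quad_ext (\<lambda>(a\<^sub>i, b\<^sub>i) (a\<^sub>j, b\<^sub>j). gen (a\<^sub>i * a\<^sub>j, b\<^sub>i, b\<^sub>j)) p +
         quad_ext (\<lambda>(a\<^sub>i, b\<^sub>i) (a\<^sub>j, b\<^sub>j). gen (a\<^sub>i, a\<^sub>j, b\<^sub>i * b\<^sub>j)) p -
         quad_ext (\<lambda>(a\<^sub>i, b\<^sub>i) (a\<^sub>j, b\<^sub>j). gen (a\<^sub>i, a\<^sub>j * b\<^sub>i, b\<^sub>j)) p"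
  let ?C = "\<lambda>u v. lin_ext scale (\<lambda>(a, b, d). scale (u a * v b) d)"
  have C: "?C u v ?T = E u v" if u: "u \<in> dual scale" and v: "v \<in> dual scale" for u v
  proof -
    let ?f = "\<lambda>u x. scale (u (fst x)) (snd x)"
    have \<rho>: "tensor_map scale r w = lin_ext scale (?f w) p" if "w \<in> dual scale" for w
      using tensor_map_coset[OF that] p by (simp add: case_prod_unfold)
    have \<rho>t: "tensor_map scale (flip scale r) w = lin_ext scale (\<lambda>x. scale (w (snd x)) (fst x)) p"
      if "w \<in> dual scale" for w
      using tensor_map_flip[OF that] p by (simp add: case_prod_unfold)
    \<comment> \<open>The sum of \<open>u(a_i a_j) v(b_i) b_j\<close>: summing over \<open>i\<close>
      first produces \<open>r^t(v)\<close> in front of \<open>a_j\<close>.\<close>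
    have 1: "?C u v (quad_ext (\<lambda>(a\<^sub>i, b\<^sub>i) (a\<^sub>j, b\<^sub>j). gen (a\<^sub>i * a\<^sub>j, b\<^sub>i, b\<^sub>j)) p)
        = tensor_map scale r (L_dual u (tensor_map scale (flip scale r) v))"
    proof -
      have "u (lin_ext scale (\<lambda>x. scale (v (snd x)) (fst x)) p * y)
          = lin_ext (*) (\<lambda>x. u (fst x * y) * v (snd x)) p" for y
        by (simp add: lin_ext_times_right dual_lin_ext[OF u] scale_mult_left dualD[OF u] mult.commute)
      then have "tensor_map scale r (L_dual u (tensor_map scale (flip scale r) v))
          = lin_ext scale (\<lambda>y. lin_ext scale (\<lambda>x. scale (u (fst x * fst y) * v (snd x)) (snd y)) p) p"
        unfolding \<rho>[OF L_dual_in_dual[OF u]] \<rho>t[OF v] by (simp only: L_dual_def scale_lin_ext)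
      also have "\<dots> = lin_ext scale (\<lambda>x. lin_ext scale (\<lambda>y. scale (u (fst x * fst y) * v (snd x)) (snd y)) p) p"
        by (rule lin_ext_swap)
      finally show ?thesis
        by (simp add: quad_ext_def lin_ext_lin_ext case_prod_unfold)
    qed
    have 2: "?C u v (quad_ext (\<lambda>(a\<^sub>i, b\<^sub>i) (a\<^sub>j, b\<^sub>j). gen (a\<^sub>i, a\<^sub>j, b\<^sub>i * b\<^sub>j)) p)
        = tensor_map scale r u * tensor_map scale r v"
      \<comment> \<open>Expanding the left factor first makes its index the outer one, as in
        \<open>quad_ext\<close>.\<close>
      unfolding \<rho>[OF u] \<rho>[OF v] quad_ext_def lin_ext_times_right
      unfolding lin_ext_times_left
      by (simp add: lin_ext_lin_ext case_prod_unfold scale_mult_left scale_mult_right mult.commute)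
    \<comment> \<open>The sum of \<open>u(a_i) v(a_j b_i) b_j\<close>: summing over \<open>i\<close>
      first produces \<open>r(u)\<close> behind \<open>a_j\<close>.\<close>
    have 3: "?C u v (quad_ext (\<lambda>(a\<^sub>i, b\<^sub>i) (a\<^sub>j, b\<^sub>j). gen (a\<^sub>i, a\<^sub>j * b\<^sub>i, b\<^sub>j)) p)
        = tensor_map scale r (R_dual (tensor_map scale r u) v)"
    proof -
      have "v (y * lin_ext scale (?f u) p) = lin_ext (*) (\<lambda>x. u (fst x) * v (y * snd x)) p" for y
        by (simp add: lin_ext_times_left dual_lin_ext[OF v] scale_mult_right dualD[OF v])
      then have "tensor_map scale r (R_dual (tensor_map scale r u) v)
          = lin_ext scale (\<lambda>y. lin_ext scale (\<lambda>x. scale (u (fst x) * v (fst y * snd x)) (snd y)) p) p"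
        unfolding \<rho>[OF R_dual_in_dual[OF v]] \<rho>[OF u] by (simp only: R_dual_def scale_lin_ext)
      also have "\<dots> = lin_ext scale (\<lambda>x. lin_ext scale (\<lambda>y. scale (u (fst x) * v (fst y * snd x)) (snd y)) p) p"
        by (rule lin_ext_swap)
      finally show ?thesis
        by (simp add: quad_ext_def lin_ext_lin_ext case_prod_unfold)
    qed
    have 4: "tensor_map scale r (w - w') = tensor_map scale r w - tensor_map scale r w'"
      if "w \<in> dual scale" "w' \<in> dual scale" for w w'
      using that by (simp add: \<rho> dual_closed scale_left_diff_distrib lin_ext_diff_fun)
    show ?thesis
      unfolding E_def lin_ext_add lin_ext_diff 1 2 3 4[OF R_dual_in_dual[OF v] L_dual_in_dual[OF u]]
      by (simp add: algebra_simps)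
  qed
  have "lin_ext free_scale (\<lambda>(p, q, t). gen (p, q, x * t) - gen (p * x, q, t)) ?T \<in> rel3 scale" for x
  proof (rule rel3_mem_if_contractions_zero)
    fix u v assume u: "u \<in> dual scale" and v: "v \<in> dual scale"
    have "?C u v (lin_ext free_scale (\<lambda>(p, q, t). gen (p, q, x * t) - gen (p * x, q, t)) t)
        = x * ?C u v t - ?C (R_dual x u) v t" for t
      by (simp add: lin_ext_lin_ext lin_ext_diff case_prod_unfold lin_ext_times_left scale_mult_right
          lin_ext_diff_fun[symmetric] R_dual_def)
    then show "?C u v (lin_ext free_scale (\<lambda>(p, q, t). gen (p, q, x * t) - gen (p * x, q, t)) ?T) = 0"
      by (simp only: C[OF u v] C[OF R_dual_in_dual[OF u] v] inv[OF u v] diff_self)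
  qed
  then show ?thesis unfolding p GAYBE_coset by blast
qed

end

section \<open>Splitting the tensor into its symmetric and antisymmetric parts\<close>

theorem proposition4p4:
  fixes scale :: "'k::field \<Rightarrow> 'a::ring \<Rightarrow> 'a"
    and r \<alpha> \<beta> :: "('a \<times> 'a \<Rightarrow>\<^sub>0 'k) set"
    and \<kappa> :: 'k
  assumes "CHAR('k) \<noteq> 2"
    and "fd_k_algebra scale"
    and "r \<in> tensor2 scale"
    and "\<alpha> = scale2 scale (1 / 2) (quot_diff (rel2 scale) r (flip scale r))"
    and "\<beta> = scale2 scale (1 / 2) (quot_add (rel2 scale) r (flip scale r))"
    and "balanced_bimodule_hom scale (tensor_map scale \<beta>)"
    and "extended_O_operator scale (tensor_map scale \<alpha>) (tensor_map scale \<beta>) \<kappa>"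
  shows "k_algebra_on fun_scale (dual scale)
           (\<lambda>u v. R_dual (tensor_map scale r u) v - L_dual u (tensor_map scale (flip scale r) v))
         \<and> GAYBE scale r"
proof -
  interpret fd_k_algebra scale by fact
  let ?\<rho> = "tensor_map scale r" and ?\<rho>t = "tensor_map scale (flip scale r)"
  let ?\<alpha> = "tensor_map scale \<alpha>" and ?\<beta> = "tensor_map scale \<beta>"
  note bal = assms(6) and ext = assms(7)
  \<comment> \<open>A divisor of 2 is 1 or 2, and a field does not have characteristic 1. So 2 is
    invertible, and the halves recombine to \<open>r\<close> and \<open>r^t\<close>.\<close>
  have "\<not> CHAR('k) dvd 2"
    using assms(1) CHAR_not_1[where 'a='k] dvd_imp_le[of "CHAR('k)" 2]
    by (auto simp: le_Suc_eq numeral_2_eq_2)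
  then have two: "(2::'k) \<noteq> 0"
    using of_nat_eq_0_iff_char_dvd[where 'a='k, of 2] by simp
  obtain p where p: "r = coset (rel2 scale) p" using assms(3) by (auto simp: tensor2_def)
  have "?\<alpha> u = scale (1 / 2) (?\<rho> u - ?\<rho>t u)" "?\<beta> u = scale (1 / 2) (?\<rho> u + ?\<rho>t u)"
    if "u \<in> dual scale" for u
    using that by (simp_all add: assms(4,5) p flip_coset scale2_coset free.quot_add_coset
        free.quot_diff_coset tensor_map_coset lin_ext_scale lin_ext_add lin_ext_diff)
  then have \<rho>: "?\<rho> u = ?\<alpha> u + ?\<beta> u" and \<rho>t: "?\<rho>t u = ?\<beta> u - ?\<alpha> u" if "u \<in> dual scale" for u
    using that two by (simp_all flip: scale_right_distrib scale_right_diff_distrib)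
      (simp_all flip: scale_left_distrib add: scale_right_distrib scale_right_diff_distrib)
  \<comment> \<open>The minus sign before \<open>L_dual\<close> is absorbed into its argument, as
    \<open>- r^t\<close> is \<open>\<alpha> - \<beta>\<close>.\<close>
  have m: "R_dual (?\<rho> u) v - L_dual u (?\<rho>t v) = R_dual (?\<alpha> u + ?\<beta> u) v + L_dual u (?\<alpha> v - ?\<beta> v)"
    if "u \<in> dual scale" "v \<in> dual scale" for u v
    using that by (simp add: \<rho> \<rho>t L_dual_diff)
  have defect: "?\<rho> u * ?\<rho> v - ?\<rho> (R_dual (?\<rho> u) v - L_dual u (?\<rho>t v)) = scale (\<kappa> + 1) (?\<beta> u * ?\<beta> v)"
    if u: "u \<in> dual scale" and v: "v \<in> dual scale" for u v
    unfolding m[OF u v] balanced_product_eq[OF bal u v]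
    using O_operator_defect(1)[OF bal ext u v] u v
    by (simp add: \<rho> dual_closed R_dual_in_dual L_dual_in_dual)
  have "?\<beta> (R_dual x u) = x * ?\<beta> u" if "u \<in> dual scale" for x u
    using bal that by (simp add: balanced_bimodule_hom_def)
  then have "GAYBE scale r"
    by (intro GAYBE_if_defect_invariant assms(3))
       (simp add: defect R_dual_in_dual scale_mult_right mult.assoc)
  then show ?thesis
    using k_algebra_on_dual[OF bal ext m] by blast
qed

end
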